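(* Let $\mathcal{X}$ and $\mathcal{Y}$ be Banach spaces and let $U$ on $\mathcal{X}$ and $V$ on $\mathcal{Y}$ be operators that are equivalent after extension. Assume that $U$ can be approximated in operator norm by invertible operators on $\mathcal{X}$, or that $V$ can be approximated in operator norm by invertible operators on $\mathcal{Y}$. Then $U$ and $V$ are Schur coupled.
   Context: "Operator" means bounded linear operator; an operator "on $\mathcal{X}$" maps $\mathcal{X}$ into $\mathcal{X}$; an operator is invertible if it is bijective with bounded inverse. $\dotplus$ denotes the direct sum of Banach spaces. An operator $T$ on a Banach space can be approximated in norm by invertible operators if it is the operator-norm limit of a sequence of invertible operators on that space. Let $U$ on $\mathcal{X}$ and $V$ on $\mathcal{Y}$ be Banach space operators. (Schur coupling) $U$ and $V$ are Schur coupled if there exists an operator matrix $S=\begin{bmatrix}A&B\\C&D\end{bmatrix}$ on $\mathcal{X}\dotplus\mathcal{Y}$ with $A$ and $D$ invertible, $U=A-BD^{-1}C$ and $V=D-CA^{-1}B$. (Equivalence after extension) $U$ and $V$ are equivalent after extension if there exist Banach spaces $\mathcal{X}_0$ and $\mathcal{Y}_0$ and invertible operators $E:\mathcal{Y}\dotplus\mathcal{Y}_0\to\mathcal{X}\dotplus\mathcal{X}_0$ and $F:\mathcal{X}\dotplus\mathcal{X}_0\to\mathcal{Y}\dotplus\mathcal{Y}_0$ such that $\begin{bmatrix}U&0\\0&I_{\mathcal{X}_0}\end{bmatrix}=E\begin{bmatrix}V&0\\0&I_{\mathcal{Y}_0}\end{bmatrix}F$. *)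

theory Defs
  imports "HOL-Analysis.Analysis"
begin

text \<open>
  The class \<^class>\<open>banach\<close> consists of real Banach spaces. In order to treat real and complex
  Banach spaces uniformly, the scalars range over a type of class \<^class>\<open>real_normed_field\<close> (whose
  norm is multiplicative), which by the Gelfand--Mazur theorem is isometrically isomorphic to the
  reals or to the complex numbers. The scalar multiplication is an explicit parameter.
\<close>

locale banach_over = vector_space scale
  for scale :: "'k::real_normed_field \<Rightarrow> 'a::banach \<Rightarrow> 'a" +
  assumes norm_scale: "norm (scale c x) = norm c * norm x"
    and scale_of_real: "scale (of_real r) x = r *\<^sub>R x"

lemma banach_over_scaleR: "banach_over ((*\<^sub>R) :: real \<Rightarrow> 'a::banach \<Rightarrow> 'a)"
  by unfold_locales (simp_all add: algebra_simps)

lemma banach_over_times: "banach_over ((*) :: 'k \<Rightarrow> 'k \<Rightarrow> 'k::{real_normed_field,banach})"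
  by unfold_locales (simp_all add: algebra_simps norm_mult scaleR_conv_of_real)

text \<open>
  The direct sum is the product type, whose norm is \<open>sqrt ((norm x)\<^sup>2 + (norm y)\<^sup>2)\<close>; this is
  equivalent to any other customary norm on the direct sum.
\<close>

abbreviation scale_sum ::
    "('k::real_normed_field \<Rightarrow> 'a::banach \<Rightarrow> 'a) \<Rightarrow> ('k \<Rightarrow> 'b::banach \<Rightarrow> 'b) \<Rightarrow> 'k \<Rightarrow> 'a \<times> 'b \<Rightarrow> 'a \<times> 'b"
  where "scale_sum \<equiv> module_prod.scale"

lemma banach_over_scale_sum:
  fixes s :: "'k::real_normed_field \<Rightarrow> 'a::banach \<Rightarrow> 'a" and t :: "'k \<Rightarrow> 'b::banach \<Rightarrow> 'b"
  assumes "banach_over s" "banach_over t"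
  shows "banach_over (scale_sum s t)"
proof -
  interpret s: banach_over s by fact
  interpret t: banach_over t by fact
  interpret st: vector_space_prod s t by unfold_locales
  show ?thesis
  proof
    fix c :: 'k and x :: "'a \<times> 'b"
    have "sqrt ((norm c * a)\<^sup>2 + (norm c * b)\<^sup>2) = norm c * sqrt (a\<^sup>2 + b\<^sup>2)" for a b
      by (simp add: power_mult_distrib real_sqrt_mult flip: distrib_left)
    then show "norm (scale_sum s t c x) = norm c * norm x"
      by (simp add: st.scale_def norm_prod_def s.norm_scale t.norm_scale)
  next
    fix r :: real and x :: "'a \<times> 'b"
    show "scale_sum s t (of_real r) x = r *\<^sub>R x"
      by (simp add: st.scale_def s.scale_of_real t.scale_of_real scaleR_prod_def)
  qed
qed

text \<open>
  Elements of the type \<open>'a \<Rightarrow>\<^sub>L 'b\<close> are bounded and real linear; an operator between Banach spaces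
  over \<open>'k\<close> has to be linear over \<open>'k\<close>. The norm of the type is the operator norm.
\<close>

definition is_operator ::
    "('k::real_normed_field \<Rightarrow> 'a::banach \<Rightarrow> 'a) \<Rightarrow> ('k \<Rightarrow> 'b::banach \<Rightarrow> 'b) \<Rightarrow> ('a \<Rightarrow>\<^sub>L 'b) \<Rightarrow> bool"
  where "is_operator s t T \<longleftrightarrow> Vector_Spaces.linear s t (blinfun_apply T)"

definition invertible_op :: "('a::banach \<Rightarrow>\<^sub>L 'b::banach) \<Rightarrow> bool"
  where "invertible_op T \<longleftrightarrow> bij (blinfun_apply T) \<and> bounded_linear (inv (blinfun_apply T))"

definition inverse_op :: "('a::banach \<Rightarrow>\<^sub>L 'b::banach) \<Rightarrow> ('b \<Rightarrow>\<^sub>L 'a)"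
  where "inverse_op T = Blinfun (inv (blinfun_apply T))"

lemma inverse_op_compose:
  assumes "invertible_op T"
  shows "inverse_op T o\<^sub>L T = id_blinfun" "T o\<^sub>L inverse_op T = id_blinfun"
proof -
  have *: "bij (blinfun_apply T)" "blinfun_apply (inverse_op T) = inv (blinfun_apply T)"
    using assms by (auto simp: invertible_op_def inverse_op_def bounded_linear_Blinfun_apply)
  show "inverse_op T o\<^sub>L T = id_blinfun"
    by (rule blinfun_eqI) (simp add: * bij_is_inj)
  show "T o\<^sub>L inverse_op T = id_blinfun"
    by (rule blinfun_eqI) (simp add: * bij_is_surj surj_f_inv_f)
qed

definition op_matrix ::
    "('a::banach \<Rightarrow>\<^sub>L 'c::banach) \<Rightarrow> ('b::banach \<Rightarrow>\<^sub>L 'c) \<Rightarrow> ('a \<Rightarrow>\<^sub>L 'd::banach) \<Rightarrow> ('b \<Rightarrow>\<^sub>L 'd) \<Rightarrow>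
      ('a \<times> 'b) \<Rightarrow>\<^sub>L ('c \<times> 'd)"
  where "op_matrix A B C D = Blinfun (\<lambda>(x, y). (A x + B y, C x + D y))"

lemma op_matrix_apply: "op_matrix A B C D (x, y) = (A x + B y, C x + D y)"
proof -
  have "bounded_linear (\<lambda>z. (A (fst z) + B (snd z), C (fst z) + D (snd z)))"
    by (intro bounded_linear_intros)
  then show ?thesis
    by (simp add: op_matrix_def bounded_linear_Blinfun_apply split_def)
qed

definition approximable_by_invertibles ::
    "('k::real_normed_field \<Rightarrow> 'a::banach \<Rightarrow> 'a) \<Rightarrow> ('a \<Rightarrow>\<^sub>L 'a) \<Rightarrow> bool"
  where "approximable_by_invertibles s T \<longleftrightarrow>
    (\<exists>R. (\<forall>n::nat. is_operator s s (R n) \<and> invertible_op (R n)) \<and> R \<longlonglongrightarrow> T)"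

definition schur_coupled ::
    "('k::real_normed_field \<Rightarrow> 'x::banach \<Rightarrow> 'x) \<Rightarrow> ('k \<Rightarrow> 'y::banach \<Rightarrow> 'y) \<Rightarrow>
      ('x \<Rightarrow>\<^sub>L 'x) \<Rightarrow> ('y \<Rightarrow>\<^sub>L 'y) \<Rightarrow> bool"
  where "schur_coupled sX sY U V \<longleftrightarrow>
    (\<exists>S A B C D. is_operator (scale_sum sX sY) (scale_sum sX sY) S \<and>
       is_operator sX sX A \<and> is_operator sY sX B \<and> is_operator sX sY C \<and> is_operator sY sY D \<and>
       S = op_matrix A B C D \<and>
       invertible_op A \<and> invertible_op D \<and>
       U = A - (B o\<^sub>L inverse_op D o\<^sub>L C) \<and>
       V = D - (C o\<^sub>L inverse_op A o\<^sub>L B))"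

text \<open>
  Types cannot be quantified existentially, so the types of the extension spaces are parameters.
  Where this notion occurs as a hypothesis, with type variables not occurring in the conclusion,
  the universal quantification over these variables amounts to an existential one in the hypothesis.
\<close>

definition equivalent_after_extension ::
    "'x0::banach itself \<Rightarrow> 'y0::banach itself \<Rightarrow>
      ('k::real_normed_field \<Rightarrow> 'x::banach \<Rightarrow> 'x) \<Rightarrow> ('k \<Rightarrow> 'y::banach \<Rightarrow> 'y) \<Rightarrow>
      ('x \<Rightarrow>\<^sub>L 'x) \<Rightarrow> ('y \<Rightarrow>\<^sub>L 'y) \<Rightarrow> bool"
  where "equivalent_after_extension _ _ sX sY U V \<longleftrightarrow>
    (\<exists>(sX0 :: 'k \<Rightarrow> 'x0 \<Rightarrow> 'x0) (sY0 :: 'k \<Rightarrow> 'y0 \<Rightarrow> 'y0)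
       (E :: ('y \<times> 'y0) \<Rightarrow>\<^sub>L ('x \<times> 'x0)) (F :: ('x \<times> 'x0) \<Rightarrow>\<^sub>L ('y \<times> 'y0)).
       banach_over sX0 \<and> banach_over sY0 \<and>
       is_operator (scale_sum sY sY0) (scale_sum sX sX0) E \<and> invertible_op E \<and>
       is_operator (scale_sum sX sX0) (scale_sum sY sY0) F \<and> invertible_op F \<and>
       op_matrix U 0 0 id_blinfun = E o\<^sub>L op_matrix V 0 0 id_blinfun o\<^sub>L F)"

end

theory Submission
  imports Defs
begin

text \<open>
  The block entries of the two invertible operators that realise the equivalence after extension
  can be rearranged into a matricial coupling: mutually inverse block operators
  \<open>M = [[U, a], [b, c]]\<close> and \<open>N = [[p, q], [r, V]]\<close> on the direct sum of the two spaces
  (\<open>matricially_coupled_if_equivalent_after_extension\<close>). If the corner \<open>p\<close> of such a coupling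
  is invertible, then so is \<open>c\<close>, whose inverse is the Schur complement of \<open>p\<close> in \<open>N\<close>, and the
  inverses of \<open>p\<close> and \<open>c\<close> are the diagonal entries of a Schur coupling
  (\<open>schur_coupled_if_invertible_corner\<close>).

  A given coupling need not have an invertible corner, but it is far from unique. Multiplying \<open>M\<close>
  from the left by a lower unitriangular block operator, and \<open>N\<close> from the right by its inverse,
  leaves the entries \<open>U\<close> and \<open>V\<close> alone and can be used to replace \<open>p\<close> by \<open>p + (1 - p U) K\<close> for
  any operator \<open>K\<close> (\<open>matricially_coupled_shear\<close>). If \<open>U\<close> had an inverse \<open>K\<close>, the new corner
  would be just \<open>K\<close>. If \<open>U\<close> is only close to an invertible operator \<open>G\<close>, take for \<open>K\<close> the
  inverse of \<open>G\<close>: the new corner is \<open>(1 + p (G - U)) K\<close>, which is invertible as soon as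
  \<open>p (G - U)\<close> has norm below 1. The case in which \<open>V\<close> is approximable follows because matricial
  coupling and Schur coupling are both symmetric.
\<close>

section \<open>Operators over the scalar field\<close>

text \<open>
  Additivity is built into the type of bounded operators, so that linearity over the scalar field
  reduces to homogeneity.
\<close>

lemma is_operator_iff:
  assumes "banach_over s" "banach_over t"
  shows "is_operator s t T \<longleftrightarrow> (\<forall>c x. T (s c x) = t c (T x))"
proof -
  interpret s: banach_over s by fact
  interpret t: banach_over t by fact
  show ?thesis
    unfolding is_operator_def Vector_Spaces.linear_def module_hom_def module_hom_axioms_def
    by (auto simp: blinfun.add_right s.vector_space_axioms t.vector_space_axioms
        s.module_axioms t.module_axioms)
qed

lemma scale_sum_apply:
  assumes "banach_over s" "banach_over t"
  shows "scale_sum s t c (x, y) = (s c x, t c y)"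
proof -
  interpret s: banach_over s by fact
  interpret t: banach_over t by fact
  interpret st: vector_space_prod s t by unfold_locales
  show ?thesis by (simp add: st.scale_def)
qed

lemma banach_over_linear:
  assumes "banach_over s"
  shows "s c (x + y) = s c x + s c y" "s c (x - y) = s c x - s c y" "s c (- x) = - s c x"
    "s c 0 = 0"
proof -
  interpret s: banach_over s by fact
  show "s c (x + y) = s c x + s c y" "s c (x - y) = s c x - s c y" "s c (- x) = - s c x"
    "s c 0 = 0"
    by (simp_all add: s.scale_right_distrib s.scale_right_diff_distrib)
qed

section \<open>Invertible operators\<close>

lemma invertible_op_if_compose:
  assumes "S o\<^sub>L T = id_blinfun" "T o\<^sub>L S = id_blinfun"
  shows "invertible_op T" "inverse_op T = S"
proof -
  have ST: "S (T x) = x" for x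
    using arg_cong[OF assms(1), of "\<lambda>R. blinfun_apply R x"] by simp
  have TS: "T (S y) = y" for y
    using arg_cong[OF assms(2), of "\<lambda>R. blinfun_apply R y"] by simp
  have inv: "inv (blinfun_apply T) = blinfun_apply S"
    by (rule inv_unique_comp) (auto simp: ST TS)
  have "bij (blinfun_apply T)"
    by (rule o_bij[of "blinfun_apply S"]) (auto simp: ST TS)
  then show "invertible_op T"
    by (simp add: invertible_op_def inv blinfun.bounded_linear_right)
  show "inverse_op T = S"
    by (simp add: inverse_op_def inv blinfun_apply_inverse)
qed

lemma inverse_op_apply:
  assumes "invertible_op T"
  shows "inverse_op T (T x) = x" "T (inverse_op T y) = y"
  using inverse_op_compose[OF assms]
  by (metis blinfun_apply_blinfun_compose blinfun_apply_id_blinfun id_apply)+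

lemma invertible_op_compose:
  assumes "invertible_op S" "invertible_op T"
  shows "invertible_op (S o\<^sub>L T)"
  by (rule invertible_op_if_compose[of "inverse_op T o\<^sub>L inverse_op S"])
    (auto intro!: blinfun_eqI simp: inverse_op_apply assms)

lemma invertible_op_inverse_op:
  assumes "invertible_op T"
  shows "invertible_op (inverse_op T)" "inverse_op (inverse_op T) = T"
  using invertible_op_if_compose[of T "inverse_op T"] inverse_op_compose[OF assms] by auto

lemma is_operator_inverse_op:
  assumes "banach_over s" "banach_over t" "is_operator s t T" "invertible_op T"
  shows "is_operator t s (inverse_op T)"
  using assms by (metis is_operator_iff inverse_op_apply)

text \<open>
  Solving \<open>(1 + T) x = y\<close> means finding a fixed point of the contraction \<open>x \<mapsto> y - T x\<close>, which
  exists and is unique. The fixed point equation also bounds the inverse by \<open>1 / (1 - norm T)\<close>.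
\<close>

lemma invertible_op_id_plus:
  fixes T :: "'a::banach \<Rightarrow>\<^sub>L 'a"
  assumes "norm T < 1"
  shows "invertible_op (id_blinfun + T)"
proof -
  have ex1: "\<exists>!x. y - T x = x" for y
  proof (rule banach_fix_type)
    show "\<forall>x z. dist (y - T x) (y - T z) \<le> norm T * dist x z"
      by (simp add: dist_norm flip: blinfun.diff_right) (metis norm_blinfun norm_minus_commute)
  qed (use assms in auto)
  have "(id_blinfun + T) x = y \<longleftrightarrow> y - T x = x" for x y
    by (auto simp: blinfun.add_left algebra_simps)
  then have bij: "bij (blinfun_apply (id_blinfun + T))"
    using ex1 by (simp add: bij_iff)
  let ?f = "inv (blinfun_apply (id_blinfun + T))"
  have f: "(id_blinfun + T) (?f y) = y" for y
    using bij by (simp add: bij_is_surj surj_f_inv_f)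
  have inj: "x = z" if "(id_blinfun + T) x = (id_blinfun + T) z" for x z
    using bij that by (meson bij_is_inj injD)
  have "bounded_linear ?f"
  proof (rule bounded_linear_intro)
    show "?f (x + y) = ?f x + ?f y" for x y
      by (rule inj) (simp add: f blinfun.add_right)
    show "?f (r *\<^sub>R x) = r *\<^sub>R ?f x" for r x
      by (rule inj) (simp add: f blinfun.scaleR_right)
    show "norm (?f y) \<le> norm y * (1 / (1 - norm T))" for y
    proof -
      have "?f y = y - T (?f y)"
        using f[of y] by (simp add: blinfun.add_left algebra_simps)
      then have "norm (?f y) \<le> norm y + norm (T (?f y))"
        by (metis norm_triangle_ineq4)
      also have "\<dots> \<le> norm y + norm T * norm (?f y)"
        by (simp add: norm_blinfun)
      finally show ?thesis
        using assms by (simp add: field_simps)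
    qed
  qed
  with bij show ?thesis by (simp add: invertible_op_def)
qed

section \<open>Block operators\<close>

lemma blinfun_eq_pointwise: "S = T \<longleftrightarrow> (\<forall>x. blinfun_apply S x = blinfun_apply T x)"
  by (auto intro: blinfun_eqI)

lemma op_matrix_eq_iff:
  "op_matrix A B C D = op_matrix A' B' C' D' \<longleftrightarrow> A = A' \<and> B = B' \<and> C = C' \<and> D = D'"
proof
  assume eq: "op_matrix A B C D = op_matrix A' B' C' D'"
  have "(A x + B y, C x + D y) = (A' x + B' y, C' x + D' y)" for x y
    by (metis eq op_matrix_apply)
  from this[of _ 0] this[of 0] show "A = A' \<and> B = B' \<and> C = C' \<and> D = D'"
    by (auto intro!: blinfun_eqI)
qed simp

lemma op_matrix_compose:
  "op_matrix A B C D o\<^sub>L op_matrix A' B' C' D' =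
    op_matrix ((A o\<^sub>L A') + (B o\<^sub>L C')) ((A o\<^sub>L B') + (B o\<^sub>L D'))
      ((C o\<^sub>L A') + (D o\<^sub>L C')) ((C o\<^sub>L B') + (D o\<^sub>L D'))"
  by (rule blinfun_eqI)
    (auto simp: op_matrix_apply blinfun.add_left blinfun.add_right split: prod.splits)

lemma op_matrix_id: "op_matrix id_blinfun 0 0 id_blinfun = id_blinfun"
  by (rule blinfun_eqI) (auto simp: op_matrix_apply split: prod.splits)

lemma is_operator_op_matrix:
  assumes "banach_over s" "banach_over t" "banach_over u" "banach_over v"
    and "is_operator s u A" "is_operator t u B" "is_operator s v C" "is_operator t v D"
  shows "is_operator (scale_sum s t) (scale_sum u v) (op_matrix A B C D)"
  using assms
  by (auto simp: is_operator_iff banach_over_scale_sum scale_sum_apply op_matrix_apply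
      banach_over_linear)

lemma is_operator_blocks:
  assumes "banach_over s" "banach_over t" "banach_over u" "banach_over v"
    and "is_operator (scale_sum s t) (scale_sum u v) T"
  obtains A B C D where "T = op_matrix A B C D"
    and "is_operator s u A" "is_operator t u B" "is_operator s v C" "is_operator t v D"
proof -
  have lin: "bounded_linear (\<lambda>x. fst (T (x, 0)))" "bounded_linear (\<lambda>y. fst (T (0, y)))"
    "bounded_linear (\<lambda>x. snd (T (x, 0)))" "bounded_linear (\<lambda>y. snd (T (0, y)))"
    by (intro bounded_linear_intros)+
  have T: "T (scale_sum s t c x) = scale_sum u v c (T x)" for c x
    using assms(5) is_operator_iff[OF banach_over_scale_sum banach_over_scale_sum] assms(1-4)
    by blast
  have T1: "T (s c x, 0) = scale_sum u v c (T (x, 0))" for c x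
    using T[of c "(x, 0)"] assms by (simp add: scale_sum_apply banach_over_linear)
  have T2: "T (0, t c y) = scale_sum u v c (T (0, y))" for c y
    using T[of c "(0, y)"] assms by (simp add: scale_sum_apply banach_over_linear)
  have sc: "fst (scale_sum u v c z) = u c (fst z)" "snd (scale_sum u v c z) = v c (snd z)" for c z
    using scale_sum_apply[OF assms(3,4), of c "fst z" "snd z"] by simp_all
  have split: "T (x, y) = T (x, 0) + T (0, y)" for x y
    by (simp flip: blinfun.add_right)
  show thesis
  proof
    show "T = op_matrix (Blinfun (\<lambda>x. fst (T (x, 0)))) (Blinfun (\<lambda>y. fst (T (0, y))))
      (Blinfun (\<lambda>x. snd (T (x, 0)))) (Blinfun (\<lambda>y. snd (T (0, y))))"
      by (rule blinfun_eqI)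
        (auto simp: op_matrix_apply lin bounded_linear_Blinfun_apply simp flip: fst_add snd_add split)
  qed (use assms(1-4) in \<open>simp_all add: is_operator_iff lin bounded_linear_Blinfun_apply T1 T2 sc\<close>)
qed

section \<open>Matricial coupling\<close>

text \<open>
  The corner \<open>p\<close> diagonally opposite to \<open>V\<close> is a parameter while the other entries are quantified,
  because the construction of a Schur coupling only asks for more about \<open>p\<close>, its invertibility.
\<close>

definition matricially_coupled ::
    "('k::real_normed_field \<Rightarrow> 'x::banach \<Rightarrow> 'x) \<Rightarrow> ('k \<Rightarrow> 'y::banach \<Rightarrow> 'y) \<Rightarrow>
      ('x \<Rightarrow>\<^sub>L 'x) \<Rightarrow> ('y \<Rightarrow>\<^sub>L 'y) \<Rightarrow> ('x \<Rightarrow>\<^sub>L 'x) \<Rightarrow> bool"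
  where "matricially_coupled sX sY U V p \<longleftrightarrow>
    (\<exists>a b c q r. is_operator sY sX a \<and> is_operator sX sY b \<and> is_operator sY sY c \<and>
       is_operator sX sX p \<and> is_operator sY sX q \<and> is_operator sX sY r \<and>
       op_matrix U a b c o\<^sub>L op_matrix p q r V = id_blinfun \<and>
       op_matrix p q r V o\<^sub>L op_matrix U a b c = id_blinfun)"

lemma op_matrix_compose_eq_id_iff:
  "op_matrix A B C D o\<^sub>L op_matrix A' B' C' D' = id_blinfun \<longleftrightarrow>
    (\<forall>x. A (A' x) + B (C' x) = x) \<and> (\<forall>y. A (B' y) + B (D' y) = 0) \<and>
    (\<forall>x. C (A' x) + D (C' x) = 0) \<and> (\<forall>y. C (B' y) + D (D' y) = y)"
  by (simp only: op_matrix_compose op_matrix_eq_iff flip: op_matrix_id)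
    (simp add: blinfun_eq_pointwise blinfun.add_left conj_ac)

lemma matricially_coupled_sym:
  assumes "matricially_coupled sX sY U V p"
  shows "\<exists>c. matricially_coupled sY sX V U c"
proof -
  from assms obtain a b c q r where "is_operator sY sX a" "is_operator sX sY b" "is_operator sY sY c"
    "is_operator sX sX p" "is_operator sY sX q" "is_operator sX sY r"
    "op_matrix U a b c o\<^sub>L op_matrix p q r V = id_blinfun"
    "op_matrix p q r V o\<^sub>L op_matrix U a b c = id_blinfun"
    unfolding matricially_coupled_def by blast
  then have "matricially_coupled sY sX V U c"
    unfolding matricially_coupled_def op_matrix_compose_eq_id_iff
    by (intro exI[of _ r] exI[of _ q] exI[of _ p] exI[of _ b] exI[of _ a])
      (auto simp: add.commute)
  then show ?thesis ..
qed

text \<open>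
  Multiplying the equation \<open>U \<oplus> 1 = E (V \<oplus> 1) F\<close> by the inverse \<open>F'\<close> of \<open>F\<close> or \<open>E'\<close> of \<open>E\<close>
  gives \<open>(U \<oplus> 1) F' = E (V \<oplus> 1)\<close> and \<open>E' (U \<oplus> 1) = (V \<oplus> 1) F\<close>. Compared blockwise, the first
  makes \<open>F11'\<close> and \<open>E11\<close> intertwine \<open>U\<close> and \<open>V\<close>, the second does so for \<open>E11'\<close> and \<open>F11\<close>. These
  four are, up to sign, the off-diagonal entries of the coupling. The corners come from
  \<open>1 - E11 E11' = E12 E21' = U F12' E21'\<close> and \<open>1 - F11 F11' = F12 F21' = F12 E21 V\<close>.
\<close>

lemma matricially_coupled_if_equivalent_after_extension:
  fixes sX :: "'k::real_normed_field \<Rightarrow> 'x::banach \<Rightarrow> 'x" and sY :: "'k \<Rightarrow> 'y::banach \<Rightarrow> 'y"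
  assumes "banach_over sX" "banach_over sY" "is_operator sX sX U" "is_operator sY sY V"
    and "equivalent_after_extension TYPE('x0::banach) TYPE('y0::banach) sX sY U V"
  shows "\<exists>p. matricially_coupled sX sY U V p"
proof -
  from assms(5) obtain sX0 :: "'k \<Rightarrow> 'x0 \<Rightarrow> 'x0" and sY0 :: "'k \<Rightarrow> 'y0 \<Rightarrow> 'y0" and E F
    where sX0: "banach_over sX0" and sY0: "banach_over sY0"
      and E: "is_operator (scale_sum sY sY0) (scale_sum sX sX0) E" "invertible_op E"
      and F: "is_operator (scale_sum sX sX0) (scale_sum sY sY0) F" "invertible_op F"
      and eq: "op_matrix U 0 0 id_blinfun = E o\<^sub>L op_matrix V 0 0 id_blinfun o\<^sub>L F"
    unfolding equivalent_after_extension_def by blast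
  note over = assms(1,2) sX0 sY0
  have E': "is_operator (scale_sum sX sX0) (scale_sum sY sY0) (inverse_op E)"
    and F': "is_operator (scale_sum sY sY0) (scale_sum sX sX0) (inverse_op F)"
    using E F over by (simp_all add: is_operator_inverse_op banach_over_scale_sum)
  obtain E11 E12 E21 E22 where Em: "E = op_matrix E11 E12 E21 E22"
    and Eo: "is_operator sY sX E11" "is_operator sY0 sX E12"
      "is_operator sY sX0 E21" "is_operator sY0 sX0 E22"
    by (rule is_operator_blocks[OF over(2,4,1,3) E(1)])
  obtain F11 F12 F21 F22 where Fm: "F = op_matrix F11 F12 F21 F22"
    and Fo: "is_operator sX sY F11" "is_operator sX0 sY F12"
      "is_operator sX sY0 F21" "is_operator sX0 sY0 F22"
    by (rule is_operator_blocks[OF over(1,3,2,4) F(1)])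
  obtain E11' E12' E21' E22' where Em': "inverse_op E = op_matrix E11' E12' E21' E22'"
    and Eo': "is_operator sX sY E11'" "is_operator sX0 sY E12'"
      "is_operator sX sY0 E21'" "is_operator sX0 sY0 E22'"
    by (rule is_operator_blocks[OF over(1,3,2,4) E'])
  obtain F11' F12' F21' F22' where Fm': "inverse_op F = op_matrix F11' F12' F21' F22'"
    and Fo': "is_operator sY sX F11'" "is_operator sY0 sX F12'"
      "is_operator sY sX0 F21'" "is_operator sY0 sX0 F22'"
    by (rule is_operator_blocks[OF over(2,4,1,3) F'])
  have "op_matrix U 0 0 id_blinfun o\<^sub>L inverse_op F = E o\<^sub>L op_matrix V 0 0 id_blinfun"
    by (rule blinfun_eqI) (simp add: eq inverse_op_apply F(2))
  then have UF: "\<And>y. U (F11' y) = E11 (V y)" "\<And>z. E12 z = U (F12' z)"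
      "\<And>y. F21' y = E21 (V y)" "\<And>z. F22' z = E22 z"
    unfolding Em Fm' op_matrix_compose op_matrix_eq_iff by (simp_all add: blinfun_eq_pointwise)
  have "inverse_op E o\<^sub>L op_matrix U 0 0 id_blinfun = op_matrix V 0 0 id_blinfun o\<^sub>L F"
    by (rule blinfun_eqI) (simp add: eq inverse_op_apply E(2))
  then have EU: "\<And>x. E11' (U x) = V (F11 x)" "\<And>z. E12' z = V (F12 z)"
      "\<And>x. F21 x = E21' (U x)" "\<And>z. E22' z = F22 z"
    unfolding Em' Fm op_matrix_compose op_matrix_eq_iff by (simp_all add: blinfun_eq_pointwise)
  have EE': "\<And>x. E11 (E11' x) + E12 (E21' x) = x" "\<And>x. E21 (E11' x) + E22 (E21' x) = 0"
    using inverse_op_compose(2)[OF E(2)] unfolding Em' unfolding Em op_matrix_compose_eq_id_iff by auto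
  have E'E: "\<And>y. E11' (E11 y) + E12' (E21 y) = y" "\<And>y. E21' (E11 y) + E22' (E21 y) = 0"
    using inverse_op_compose(1)[OF E(2)] unfolding Em' unfolding Em op_matrix_compose_eq_id_iff by auto
  have FF': "\<And>y. F11 (F11' y) + F12 (F21' y) = y" "\<And>y. F11 (F12' y) + F12 (F22' y) = 0"
    using inverse_op_compose(2)[OF F(2)] unfolding Fm' unfolding Fm op_matrix_compose_eq_id_iff by auto
  have F'F: "\<And>x. F11' (F11 x) + F12' (F21 x) = x" "\<And>z. F11' (F12 z) + F12' (F22 z) = 0"
    using inverse_op_compose(1)[OF F(2)] unfolding Fm' unfolding Fm op_matrix_compose_eq_id_iff by auto
  let ?p = "F12' o\<^sub>L E21'" and ?c = "F12 o\<^sub>L E21"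
  have MN: "op_matrix U E11 (- F11) ?c o\<^sub>L op_matrix ?p (- F11') E11' V = id_blinfun"
    unfolding op_matrix_compose_eq_id_iff
  proof (intro conjI allI)
    fix x
    show "U (?p x) + E11 (E11' x) = x"
      using EE'(1)[of x] by (simp add: UF(2) add.commute)
    have "F11 (?p x) = - F12 (E22 (E21' x))"
      using FF'(2)[of "E21' x"] by (simp add: UF(4) eq_neg_iff_add_eq_0)
    also have "E22 (E21' x) = - E21 (E11' x)"
      using EE'(2)[of x] by (simp add: eq_neg_iff_add_eq_0 add.commute)
    finally show "(- F11) (?p x) + ?c (E11' x) = 0"
      by (simp add: blinfun.minus_left blinfun.minus_right)
  next
    fix y
    show "U ((- F11') y) + E11 (V y) = 0"
      by (simp add: blinfun.minus_left blinfun.minus_right UF(1))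
    show "(- F11) ((- F11') y) + ?c (V y) = y"
      using FF'(1)[of y] by (simp add: blinfun.minus_left blinfun.minus_right UF(3))
  qed
  have NM: "op_matrix ?p (- F11') E11' V o\<^sub>L op_matrix U E11 (- F11) ?c = id_blinfun"
    unfolding op_matrix_compose_eq_id_iff
  proof (intro conjI allI)
    fix x
    show "?p (U x) + (- F11') ((- F11) x) = x"
      using F'F(1)[of x]
      by (simp add: blinfun.minus_left blinfun.minus_right EU(3) add.commute)
    show "E11' (U x) + V ((- F11) x) = 0"
      by (simp add: blinfun.minus_left blinfun.minus_right EU(1))
  next
    fix y
    have "F11' (?c y) = - F12' (F22 (E21 y))"
      using F'F(2)[of "E21 y"] by (simp add: eq_neg_iff_add_eq_0)
    also have "F22 (E21 y) = - E21' (E11 y)"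
      using E'E(2)[of y] by (simp add: EU(4) eq_neg_iff_add_eq_0 add.commute)
    finally show "?p (E11 y) + (- F11') (?c y) = 0"
      by (simp add: blinfun.minus_left blinfun.minus_right)
    show "E11' (E11 y) + V (?c y) = y"
      using E'E(1)[of y] by (simp add: EU(2))
  qed
  have "is_operator sX sY (- F11)" "is_operator sY sY ?c"
    "is_operator sX sX ?p" "is_operator sY sX (- F11')"
    using Eo Fo Eo' Fo' over by (simp_all add: is_operator_iff blinfun.minus_left banach_over_linear)
  with Eo(1) Eo'(1) MN NM have "matricially_coupled sX sY U V ?p"
    unfolding matricially_coupled_def by blast
  then show ?thesis ..
qed

text \<open>
  With \<open>P\<close> the inverse of \<open>p\<close> and \<open>D = V - r P q\<close> the Schur complement of \<open>p\<close> in \<open>N\<close>, the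
  operator \<open>D\<close> is the inverse of \<open>c\<close>, and the Schur coupling is \<open>[[P, P q], [- r P, D]]\<close>: here
  \<open>V = D + r P q\<close> holds by the choice of \<open>D\<close>, while \<open>c r = - b p\<close> and \<open>p U = 1 - q b\<close> give
  \<open>P + P q c r P = P - P q b = U\<close>.
\<close>

lemma schur_coupled_if_invertible_corner:
  assumes sX: "banach_over sX" and sY: "banach_over sY"
    and V: "is_operator sY sY V"
    and "matricially_coupled sX sY U V p" and p: "invertible_op p"
  shows "schur_coupled sX sY U V"
proof -
  from assms(4) obtain a b c q r where ops: "is_operator sY sX a" "is_operator sX sY b"
      "is_operator sY sY c" "is_operator sX sX p" "is_operator sY sX q" "is_operator sX sY r"
    and MN: "op_matrix U a b c o\<^sub>L op_matrix p q r V = id_blinfun"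
    and NM: "op_matrix p q r V o\<^sub>L op_matrix U a b c = id_blinfun"
    unfolding matricially_coupled_def by blast
  have MN: "\<And>x. b (p x) + c (r x) = 0" "\<And>y. b (q y) + c (V y) = y"
    and NM: "\<And>x. p (U x) + q (b x) = x" "\<And>y. p (a y) + q (c y) = 0"
      "\<And>y. r (a y) + V (c y) = y"
    using MN NM unfolding op_matrix_compose_eq_id_iff by blast+
  define P where "P = inverse_op p"
  have Pp: "P (p x) = x" and pP: "p (P x) = x" for x
    by (simp_all add: P_def inverse_op_apply p)
  have opP: "is_operator sX sX P"
    using ops sX p by (simp add: P_def is_operator_inverse_op)
  define D where "D = V - (r o\<^sub>L P o\<^sub>L q)"
  have cr: "c (r x) = - b (p x)" for x
    using MN(1)[of x] by (simp add: eq_neg_iff_add_eq_0 add.commute)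
  have qc: "q (c y) = - p (a y)" for y
    using NM(2)[of y] by (simp add: eq_neg_iff_add_eq_0 add.commute)
  have "c o\<^sub>L D = id_blinfun"
    using MN(2) by (intro blinfun_eqI)
      (simp add: D_def blinfun.diff_left blinfun.diff_right cr pP add.commute)
  moreover have "D o\<^sub>L c = id_blinfun"
    using NM(3) by (intro blinfun_eqI)
      (simp add: D_def blinfun.diff_left blinfun.minus_right qc Pp add.commute)
  ultimately have D: "invertible_op D" "inverse_op D = c"
    by (rule invertible_op_if_compose)+
  have opD: "is_operator sY sY D"
    using sX sY ops opP V
    by (simp add: D_def is_operator_iff blinfun.diff_left banach_over_linear)
  have U: "U = P - ((P o\<^sub>L q) o\<^sub>L c o\<^sub>L (- (r o\<^sub>L P)))"
  proof (rule blinfun_eqI)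
    fix x
    have "U x = P (p (U x))" by (simp add: Pp)
    also have "p (U x) = x - q (b x)"
      using NM(1)[of x] by (simp add: eq_diff_eq)
    finally show "U x = (P - ((P o\<^sub>L q) o\<^sub>L c o\<^sub>L (- (r o\<^sub>L P)))) x"
      by (simp add: blinfun.diff_left blinfun.diff_right blinfun.minus_left blinfun.minus_right cr pP)
  qed
  have V': "V = D - ((- (r o\<^sub>L P)) o\<^sub>L p o\<^sub>L (P o\<^sub>L q))"
    by (rule blinfun_eqI) (simp add: D_def blinfun.diff_left blinfun.minus_left pP)
  have opB: "is_operator sY sX (P o\<^sub>L q)" and opC: "is_operator sX sY (- (r o\<^sub>L P))"
    using sX sY ops opP by (simp_all add: is_operator_iff blinfun.minus_left banach_over_linear)
  have "invertible_op P" "inverse_op P = p"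
    using p by (simp_all add: P_def invertible_op_inverse_op)
  then show ?thesis
    unfolding schur_coupled_def
    using is_operator_op_matrix[OF sX sY sX sY opP opB opC opD] opP opB opC opD D U V'
    by (intro exI[of _ "op_matrix P (P o\<^sub>L q) (- (r o\<^sub>L P)) D"] exI[of _ P] exI[of _ D]
        exI[of _ "P o\<^sub>L q"] exI[of _ "- (r o\<^sub>L P)"]) simp
qed

text \<open>
  Here \<open>M\<close> is multiplied from the left by \<open>[[1, 0], [- b K, 1]]\<close> and \<open>N\<close> from the right by the
  inverse \<open>[[1, 0], [b K, 1]]\<close>. The new corner is \<open>p + q b K\<close>, and \<open>q b = 1 - p U\<close> removes the
  dependence on the other entries.
\<close>

lemma matricially_coupled_shear:
  assumes sX: "banach_over sX" and sY: "banach_over sY"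
    and U: "is_operator sX sX U" and V: "is_operator sY sY V"
    and K: "is_operator sX sX K" and "matricially_coupled sX sY U V p"
  shows "matricially_coupled sX sY U V (p + ((id_blinfun - (p o\<^sub>L U)) o\<^sub>L K))"
proof -
  from assms(6) obtain a b c q r where ops: "is_operator sY sX a" "is_operator sX sY b"
      "is_operator sY sY c" "is_operator sX sX p" "is_operator sY sX q" "is_operator sX sY r"
    and MN: "op_matrix U a b c o\<^sub>L op_matrix p q r V = id_blinfun"
    and NM: "op_matrix p q r V o\<^sub>L op_matrix U a b c = id_blinfun"
    unfolding matricially_coupled_def by blast
  have MN: "a (r x) = x - U (p x)" "a (V y) = - U (q y)" "c (r x) = - b (p x)"
      "c (V y) = y - b (q y)" for x y
    using MN unfolding op_matrix_compose_eq_id_iff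
    by (simp_all add: eq_diff_eq eq_neg_iff_add_eq_0 add.commute)
  have NM: "p (U x) = x - q (b x)" "p (a y) = - q (c y)" "r (U x) = - V (b x)"
      "r (a y) = y - V (c y)" for x y
    using NM unfolding op_matrix_compose_eq_id_iff
    by (simp_all add: eq_diff_eq eq_neg_iff_add_eq_0)
  let ?z = "b o\<^sub>L K"
  let ?b = "b - (?z o\<^sub>L U)" and ?c = "c - (?z o\<^sub>L a)" and ?p = "p + (q o\<^sub>L ?z)" and ?r = "r + (V o\<^sub>L ?z)"
  have p: "p + ((id_blinfun - (p o\<^sub>L U)) o\<^sub>L K) = ?p"
    by (rule blinfun_eqI) (simp add: blinfun.bilinear_simps NM)
  have "op_matrix U a ?b ?c o\<^sub>L op_matrix ?p q ?r V = id_blinfun"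
    unfolding op_matrix_compose_eq_id_iff by (simp add: blinfun.bilinear_simps MN)
  moreover have "op_matrix ?p q ?r V o\<^sub>L op_matrix U a ?b ?c = id_blinfun"
    unfolding op_matrix_compose_eq_id_iff by (simp add: blinfun.bilinear_simps NM)
  moreover have "is_operator sX sY ?b" "is_operator sY sY ?c" "is_operator sX sX ?p"
    "is_operator sX sY ?r"
    using ops U V K sX sY
    by (simp_all add: is_operator_iff blinfun.add_left blinfun.diff_left banach_over_linear)
  ultimately show ?thesis
    unfolding p matricially_coupled_def using ops(1,5) by blast
qed

lemma schur_coupled_if_approximable:
  assumes sX: "banach_over sX" and sY: "banach_over sY"
    and U: "is_operator sX sX U" and V: "is_operator sY sY V"
    and mc: "matricially_coupled sX sY U V p"
    and "approximable_by_invertibles sX U"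
  shows "schur_coupled sX sY U V"
proof -
  from assms(6) obtain R where R: "\<And>n::nat. is_operator sX sX (R n)" "\<And>n. invertible_op (R n)"
    and lim: "R \<longlonglongrightarrow> U"
    unfolding approximable_by_invertibles_def by blast
  have "(\<lambda>n. p o\<^sub>L (R n - U)) \<longlonglongrightarrow> (p o\<^sub>L (U - U))"
    by (intro bounded_bilinear.tendsto[OF bounded_bilinear_blinfun_compose] tendsto_intros lim)
  then have "(\<lambda>n. norm (p o\<^sub>L (R n - U))) \<longlonglongrightarrow> 0"
    by (simp add: tendsto_norm_zero)
  then have "\<forall>\<^sub>F n in sequentially. norm (p o\<^sub>L (R n - U)) < 1"
    by (rule order_tendstoD) simp
  then obtain n where n: "norm (p o\<^sub>L (R n - U)) < 1"
    by (auto simp: eventually_sequentially)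
  define K where "K = inverse_op (R n)"
  have K: "is_operator sX sX K" "invertible_op K"
    using sX R by (simp_all add: K_def is_operator_inverse_op invertible_op_inverse_op)
  \<comment> \<open>Since \<open>K\<close> is the inverse of \<open>R n\<close>, the terms \<open>p\<close> and \<open>p R n K\<close> agree.\<close>
  have "p + ((id_blinfun - (p o\<^sub>L U)) o\<^sub>L K) = (id_blinfun + (p o\<^sub>L (R n - U))) o\<^sub>L K"
    by (rule blinfun_eqI) (simp add: K_def blinfun.bilinear_simps inverse_op_apply R)
  then have "invertible_op (p + ((id_blinfun - (p o\<^sub>L U)) o\<^sub>L K))"
    using invertible_op_compose[OF invertible_op_id_plus[OF n] K(2)] by simp
  with matricially_coupled_shear[OF sX sY U V K(1) mc] show ?thesis
    by (rule schur_coupled_if_invertible_corner[OF sX sY V])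
qed

lemma schur_coupled_sym:
  assumes "banach_over sX" "banach_over sY" "schur_coupled sX sY U V"
  shows "schur_coupled sY sX V U"
proof -
  from assms(3) obtain A B C D where ops: "is_operator sX sX A" "is_operator sY sX B"
      "is_operator sX sY C" "is_operator sY sY D"
    and "invertible_op A" "invertible_op D" "U = A - (B o\<^sub>L inverse_op D o\<^sub>L C)"
      "V = D - (C o\<^sub>L inverse_op A o\<^sub>L B)"
    unfolding schur_coupled_def by blast
  moreover have "is_operator (scale_sum sY sX) (scale_sum sY sX) (op_matrix D C B A)"
    by (intro is_operator_op_matrix assms ops)
  ultimately show ?thesis
    unfolding schur_coupled_def by blast
qed

theorem theorem1p4:
  fixes sX :: "'k::real_normed_field \<Rightarrow> 'x::banach \<Rightarrow> 'x"
    and sY :: "'k \<Rightarrow> 'y::banach \<Rightarrow> 'y"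
    and U :: "'x \<Rightarrow>\<^sub>L 'x" and V :: "'y \<Rightarrow>\<^sub>L 'y"
  assumes "banach_over sX" and "banach_over sY"
    and "is_operator sX sX U" and "is_operator sY sY V"
    and "equivalent_after_extension TYPE('x0::banach) TYPE('y0::banach) sX sY U V"
    and "approximable_by_invertibles sX U \<or> approximable_by_invertibles sY V"
  shows "schur_coupled sX sY U V"
proof -
  obtain p where p: "matricially_coupled sX sY U V p"
    using matricially_coupled_if_equivalent_after_extension[OF assms(1-5)] ..
  from assms(6) show ?thesis
  proof
    assume "approximable_by_invertibles sX U"
    then show ?thesis
      by (rule schur_coupled_if_approximable[OF assms(1-4) p])
  next
    assume approx: "approximable_by_invertibles sY V"
    obtain c where "matricially_coupled sY sX V U c"
      using matricially_coupled_sym[OF p] ..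
    then have "schur_coupled sY sX V U"
      by (rule schur_coupled_if_approximable[OF assms(2,1,4,3) _ approx])
    then show ?thesis
      by (rule schur_coupled_sym[OF assms(2,1)])
  qed
qed

end
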